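(* Let $p$ and $q$ be integers such that $p\le -2$, $q\ge 4$ and $q>|p|+1$. Then $$\begin{aligned}\sum_{k = 1}^\infty \Big(\frac{-27F_p F_{p + q}}{F_q^2} \Big)^{k}\frac{F_{(2p + q)k}}{k^2 \binom{3k}{k}} &= \frac{6}{\sqrt 5} \Bigg( \arctan ^2 \bigg( \frac{\sqrt 3\,\sqrt[3]{F_{p + q}} }{2\sqrt[3]{\alpha^q F_p} + \sqrt[3]{F_{p + q}} } \bigg) - \arctan ^2 \bigg( \frac{\sqrt 3 \sqrt[3]{F_p}}{2\sqrt[3]{\alpha^qF_{p + q}} +(-1)^q \sqrt[3]{F_p} } \bigg) \Bigg)\\ &\quad - \frac{\sqrt 5}{10}\Bigg( \log ^2 \bigg( \frac{(-1)^pF_q}{ \big(\sqrt[3]{\alpha^pF_{p+q}} - \sqrt[3]{\alpha^{p+q}F_{p}} \big)^3 }\bigg) - \log^2 \bigg( \frac{\alpha ^{p + q} F_q }{\big(\sqrt[3]{\alpha ^q F_{p + q}} -(-1)^q \sqrt[3]{F_p}\big)^3 } \bigg ) \Bigg),\end{aligned}$$ and $$\begin{aligned}\sum_{k = 1}^\infty \Big(\frac{- 27F_pF_{p + q}}{F_q^2} \Big)^k \frac{L_{(2p + q)k}}{k^2\binom{3k}{k}} &= 6\Bigg( \arctan ^2 \bigg( \frac{\sqrt 3\,\sqrt[3]{F_{p + q}}}{2\sqrt[3]{\alpha^q F_p} + \sqrt[3]{F_{p + q}} } \bigg) + \arctan ^2 \bigg( \frac{\sqrt 3 \sqrt[3]{F_p}}{2\sqrt[3]{\alpha^qF_{p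 + q}} +(-1)^q \sqrt[3]{F_p} } \bigg) \Bigg)\\ &\quad - \frac{1}{2}\Bigg( \log ^2 \bigg( \frac{(-1)^p F_q}{\big(\sqrt[3]{\alpha^pF_{p+q}} - \sqrt[3]{\alpha^{p+q}F_{p}} \big)^3 }\bigg) + \log^2 \bigg( \frac{\alpha ^{p + q} F_q }{\big(\sqrt[3]{\alpha ^q F_{p + q}} -(-1)^q \sqrt[3]{F_p}\big)^3 } \bigg ) \Bigg).\end{aligned}$$
   Context: $F_n$ and $L_n$ are the Fibonacci and Lucas numbers, defined by $F_0=0$, $F_1=1$, $L_0=2$, $L_1=1$, $X_n=X_{n-1}+X_{n-2}$, and extended to negative indices by $F_{-j}=(-1)^{j-1}F_j$, $L_{-j}=(-1)^jL_j$. $\alpha=(1+\sqrt5)/2$. $\sqrt[3]{t}$ denotes the real cube root (negative for $t<0$). *)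

theory Defs
  imports "HOL-Analysis.Analysis"
begin

fun fibn :: "nat \<Rightarrow> int" where
  "fibn 0 = 0" | "fibn (Suc 0) = 1" | "fibn (Suc (Suc n)) = fibn (Suc n) + fibn n"

fun lucn :: "nat \<Rightarrow> int" where
  "lucn 0 = 2" | "lucn (Suc 0) = 1" | "lucn (Suc (Suc n)) = lucn (Suc n) + lucn n"

definition F :: "int \<Rightarrow> int" where
  "F n = (if n \<ge> 0 then fibn (nat n) else (-1) ^ (nat (-n) + 1) * fibn (nat (-n)))"

definition L :: "int \<Rightarrow> int" where
  "L n = (if n \<ge> 0 then lucn (nat n) else (-1) ^ (nat (-n)) * lucn (nat (-n)))"

definition alpha :: real where "alpha = (1 + sqrt 5) / 2"

text \<open>real cube root (negative for negative arguments)\<close>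
abbreviation cbrt :: "real \<Rightarrow> real" where "cbrt x \<equiv> root 3 x"

end

theory Submission
  imports Defs
begin

text \<open>
  By Binet's formulas both sums are combinations of the values of
  $S(x) = \sum_{k\ge1} x^k / (k^2 \binom{3k}{k})$ at the two points $z\alpha^{2p+q}$ and $z\beta^{2p+q}$.
  The Fibonacci identity $F_m\alpha^{m+n} + (-1)^m F_n = \alpha^m F_{m+n}$ (with $m = -p$, $n = p+q$, and
  with $m$, $n$ exchanged) puts both points in the form $x = -27v^3/(1-v^3)^2$, where $v$ is the quotient of
  the two cube roots in the respective arctangent. In terms of $v$,
  $S(x) = 6\theta^2 - \lambda^2/2$ with $\theta = \arctan(\sqrt3 v/(2+v))$ and
  $\lambda = \log((1-v^3)/(1-v)^3)$.

  For the closed form: the coefficients are hypergeometric, so $x S'$ satisfies a second-order linear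
  inhomogeneous equation, whose homogeneous solutions are $v/(1+v^3)$ and $v^2/(1+v^3)$. Variation of
  constants, $x S' = (f v + g v^2)/(1+v^3)$, gives $f' = -6v/(1-v^3)$ and $g' = -6/(1-v^3)$, that is
  $f = 2\sqrt3\theta - \lambda$ and $g = -2\sqrt3\theta - \lambda$.
\<close>

section \<open>The coefficients, their recurrence and the radius of convergence\<close>

text \<open>The coefficient at $k = 0$ is $1/0 = 0$.\<close>

definition binom3_coeff :: "nat \<Rightarrow> real" where
  "binom3_coeff k = 1 / (real (k^2) * real ((3 * k) choose k))"

lemma choose_3k_k_Suc:
  "real ((3 * Suc k) choose Suc k) * (2 * (real k + 1) * (2 * real k + 1))
     = 3 * (3 * real k + 2) * (3 * real k + 1) * real ((3 * k) choose k)"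
proof -
  have e: "3 * Suc k = Suc (Suc (Suc (3 * k)))" "3 * Suc k - Suc k = Suc (Suc (2 * k))"
    "3 * k - k = 2 * k" by simp_all
  have "real ((3 * Suc k) choose Suc k) = fact (3 * Suc k) / (fact (Suc k) * fact (3 * Suc k - Suc k))"
    by (rule binomial_fact) simp
  also have "\<dots> = 3 * (real k + 1) * (3 * real k + 2) * (3 * real k + 1) * fact (3 * k) /
      ((real k + 1) * fact k * (2 * (real k + 1) * (2 * real k + 1) * fact (2 * k)))"
    unfolding e by (simp add: algebra_simps)
  also have "\<dots> = 3 * (3 * real k + 2) * (3 * real k + 1) * fact (3 * k) /
      (fact k * (2 * (real k + 1) * (2 * real k + 1) * fact (2 * k)))"
    by (subst frac_eq_eq) (auto simp: add_nonneg_eq_0_iff algebra_simps)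
  also have "\<dots> = 3 * (3 * real k + 2) * (3 * real k + 1) * (fact (3 * k) / (fact k * fact (2 * k)))
      / (2 * (real k + 1) * (2 * real k + 1))"
    by (simp add: mult_ac)
  also have "fact (3 * k) / (fact k * fact (2 * k)) = real ((3 * k) choose k)"
    using binomial_fact[of k "3 * k", where 'a=real] e(3) by simp
  finally have "real ((3 * Suc k) choose Suc k) = 3 * (3 * real k + 2) * (3 * real k + 1) * real ((3 * k) choose k)
      / (2 * (real k + 1) * (2 * real k + 1))" .
  moreover have "2 * (real k + 1) * (2 * real k + 1) \<noteq> 0" by (simp add: add_nonneg_eq_0_iff)
  ultimately show ?thesis
    by (metis nonzero_eq_divide_eq)
qed

text \<open>At \<open>k = 0\<close> the right side would be 0 and the left side 2. This defect
  becomes the inhomogeneity of the differential equation.\<close>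

lemma binom3_coeff_Suc:
  "3 * (k + 1) * (3 * k + 2) * (3 * k + 1) * binom3_coeff (Suc k) = 2 * real k^2 * (2 * k + 1) * binom3_coeff k" if "k > 0"
proof -
  define b where "b = real ((3 * k) choose k)"
  define b' where "b' = real ((3 * Suc k) choose Suc k)"
  have "b' * (2 * (real k + 1) * (2 * real k + 1)) = 3 * (3 * real k + 2) * (3 * real k + 1) * b"
    using choose_3k_k_Suc[of k] unfolding b_def b'_def .
  moreover have "binom3_coeff k * (real k ^ 2 * b) = 1" "binom3_coeff (Suc k) * ((real k + 1) ^ 2 * b') = 1"
    using that unfolding binom3_coeff_def b_def b'_def by (simp_all add: add.commute)
  ultimately have "3 * (real k + 1) * (3 * real k + 2) * (3 * real k + 1) * binom3_coeff (Suc k)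
      = 2 * (real k)^2 * (2 * real k + 1) * binom3_coeff k"
    by algebra
  then show ?thesis by simp
qed

lemma binom3_coeff_nonneg: "binom3_coeff k \<ge> 0"
  by (simp add: binom3_coeff_def)

lemma binom3_coeff_1: "binom3_coeff (Suc 0) = 1 / 3"
  by (simp add: binom3_coeff_def)

text \<open>The recurrence bounds the quotient of consecutive coefficients by 4/27; the factor 9/4
  gives equality at \<open>k = 1\<close>.\<close>

lemma binom3_coeff_le: "binom3_coeff k \<le> 9 / 4 * (4 / 27) ^ k"
proof (cases k)
  case 0
  then show ?thesis by (simp add: binom3_coeff_def)
next
  case (Suc m)
  have "binom3_coeff (Suc m) \<le> 9 / 4 * (4 / 27) ^ Suc m"
  proof (induction m)
    case 0
    show ?case by (simp add: binom3_coeff_1)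
  next
    case (Suc m)
    define k where "k = Suc m"
    define u where "u = 3 * (real k + 1) * (3 * k + 2) * (3 * k + 1)"
    have u: "u > 0" unfolding u_def by (auto intro!: mult_pos_pos)
    have "u * binom3_coeff (Suc k) = (2 * real k^2 * (2 * k + 1)) * binom3_coeff k"
      using binom3_coeff_Suc[of k] by (simp add: k_def u_def)
    also have "\<dots> \<le> (4 / 27 * u) * binom3_coeff k"
    proof (rule mult_right_mono[OF _ binom3_coeff_nonneg])
      \<comment> \<open>The cubic terms cancel, leaving a polynomial in \<open>k\<close> with
        nonnegative coefficients.\<close>
      have "0 \<le> 4 / 27 * u - 2 * real k^2 * (2 * k + 1)"
        unfolding u_def by (simp add: field_simps power2_eq_square)
      then show "2 * real k^2 * (2 * k + 1) \<le> 4 / 27 * u" by simp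
    qed
    also have "\<dots> = u * (4 / 27 * binom3_coeff k)" by simp
    finally have "binom3_coeff (Suc k) \<le> 4 / 27 * binom3_coeff k" using u by simp
    with Suc.IH show ?case by (simp add: k_def)
  qed
  then show ?thesis using Suc by simp
qed

lemma summable_binom3_coeff: "summable (\<lambda>k. binom3_coeff k * x ^ k)" if "norm x < 27 / 4" for x :: real
proof (rule summable_comparison_test')
  show "summable (\<lambda>k. 9 / 4 * (4 / 27 * \<bar>x\<bar>) ^ k)"
    using that by (intro summable_mult summable_geometric) auto
  show "norm (binom3_coeff k * x ^ k) \<le> 9 / 4 * (4 / 27 * \<bar>x\<bar>) ^ k" for k
    using mult_right_mono[OF binom3_coeff_le[of k], of "\<bar>x\<bar> ^ k"] binom3_coeff_nonneg[of k]
    by (simp add: abs_mult power_abs power_mult_distrib power_divide)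
qed

section \<open>The power series, its derivatives and the differential equation\<close>

definition binom3_ser :: "real \<Rightarrow> real" where "binom3_ser x = (\<Sum>k. binom3_coeff k * x ^ k)"

definition binom3_ser1 :: "real \<Rightarrow> real" where "binom3_ser1 x = (\<Sum>k. diffs binom3_coeff k * x ^ k)"

definition binom3_ser2 :: "real \<Rightarrow> real" where "binom3_ser2 x = (\<Sum>k. diffs (diffs binom3_coeff) k * x ^ k)"

definition binom3_ser3 :: "real \<Rightarrow> real" where "binom3_ser3 x = (\<Sum>k. diffs (diffs (diffs binom3_coeff)) k * x ^ k)"

lemma summable_diffs_binom3_coeff:
  fixes x :: real
  assumes "norm x < 27 / 4"
  shows "summable (\<lambda>k. diffs binom3_coeff k * x ^ k)" "summable (\<lambda>k. diffs (diffs binom3_coeff) k * x ^ k)"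
    "summable (\<lambda>k. diffs (diffs (diffs binom3_coeff)) k * x ^ k)"
proof -
  have 1: "summable (\<lambda>k. diffs binom3_coeff k * y ^ k)" if "norm y < 27/4" for y
    using termdiff_converges[OF that summable_binom3_coeff] by blast
  have 2: "summable (\<lambda>k. diffs (diffs binom3_coeff) k * y ^ k)" if "norm y < 27/4" for y
    using termdiff_converges[OF that 1] by blast
  show "summable (\<lambda>k. diffs binom3_coeff k * x ^ k)" "summable (\<lambda>k. diffs (diffs binom3_coeff) k * x ^ k)"
    "summable (\<lambda>k. diffs (diffs (diffs binom3_coeff)) k * x ^ k)"
    using 1 2 termdiff_converges[OF assms 2] assms by blast+
qed

lemma DERIV_binom3_ser: "(binom3_ser has_real_derivative binom3_ser1 x) (at x)" if "norm x < 27 / 4"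
  unfolding binom3_ser_def[abs_def] binom3_ser1_def using that summable_binom3_coeff by (rule termdiffs_strong'[rotated])

lemma DERIV_binom3_ser1: "(binom3_ser1 has_real_derivative binom3_ser2 x) (at x)" if "norm x < 27 / 4"
  unfolding binom3_ser1_def[abs_def] binom3_ser2_def using that summable_diffs_binom3_coeff(1) by (rule termdiffs_strong'[rotated])

lemma DERIV_binom3_ser2: "(binom3_ser2 has_real_derivative binom3_ser3 x) (at x)" if "norm x < 27 / 4"
  unfolding binom3_ser2_def[abs_def] binom3_ser3_def using that summable_diffs_binom3_coeff(2) by (rule termdiffs_strong'[rotated])

text \<open>The recurrence is multiplied by \<open>x ^ Suc k\<close> and summed. Writing the
  polynomials in \<open>k\<close> in the basis \<open>k * (k - 1)\<close>, \<open>k\<close>, 1 turns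
  them into \<open>x^2\<close> times the second derivative, \<open>x\<close> times the first, and
  the function itself.\<close>

lemma binom3_ser1_ode:
  assumes x: "norm x < 27 / 4"
  shows "(27 - 4 * x) * x^2 * binom3_ser3 x + (54 * x - 14 * x^2) * binom3_ser2 x + (6 - 6 * x) * binom3_ser1 x = 2"
proof -
  define c where "c = diffs binom3_coeff"
  have s0: "(\<lambda>k. c k * x ^ k) sums binom3_ser1 x"
    using summable_diffs_binom3_coeff(1)[OF x] by (simp add: c_def binom3_ser1_def summable_sums)
  have "(\<lambda>k. x * (real k * c k * x ^ (k - Suc 0))) sums (x * binom3_ser2 x)"
    using diffs_equiv[OF summable_diffs_binom3_coeff(2)[OF x]] unfolding c_def binom3_ser2_def
    by (intro sums_mult)
  then have s1: "(\<lambda>k. real k * c k * x ^ k) sums (x * binom3_ser2 x)"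
    by (rule back_subst[of "\<lambda>f. f sums _"]) (auto simp: fun_eq_iff power_eq_if)
  have "(\<lambda>k. x * (real k * diffs c k * x ^ (k - Suc 0))) sums (x * binom3_ser3 x)"
    using diffs_equiv[OF summable_diffs_binom3_coeff(3)[OF x]] unfolding c_def binom3_ser3_def
    by (intro sums_mult)
  then have "(\<lambda>k. real k * diffs c k * x ^ k) sums (x * binom3_ser3 x)"
    by (rule back_subst[of "\<lambda>f. f sums _"]) (auto simp: fun_eq_iff power_eq_if)
  then have "(\<lambda>k. x * (real k * diffs c k * x ^ k)) sums (x * (x * binom3_ser3 x))"
    by (rule sums_mult)
  then have "(\<lambda>k. real (Suc k) * real k * c (Suc k) * x ^ Suc k) sums (x^2 * binom3_ser3 x)"
    by (simp add: diffs_def power2_eq_square mult_ac)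
  then have s2: "(\<lambda>k. real k * (real k - 1) * c k * x ^ k) sums (x^2 * binom3_ser3 x)"
    using sums_Suc_iff[of "\<lambda>k. real k * (real k - 1) * c k * x ^ k" "x\<^sup>2 * binom3_ser3 x"] by (simp add: mult_ac)
  have "(\<lambda>k. 27 * (real k * (real k - 1) * c k * x ^ k) + 54 * (real k * c k * x ^ k) + 6 * (c k * x ^ k))
      sums (27 * (x^2 * binom3_ser3 x) + 54 * (x * binom3_ser2 x) + 6 * binom3_ser1 x)"
    by (intro sums_add sums_mult s0 s1 s2)
  then have "(\<lambda>k. 3 * (3 * real k + 2) * (3 * real k + 1) * c k * x ^ k)
      sums (27 * (x^2 * binom3_ser3 x) + 54 * (x * binom3_ser2 x) + 6 * binom3_ser1 x)"
    by (simp add: algebra_simps)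
  \<comment> \<open>The removed term at \<open>k = 0\<close> is 3 * 2 * 1 * \<open>c 0\<close> = 2,
    the right-hand side of the equation.\<close>
  then have lhs: "(\<lambda>k. 3 * (3 * real (Suc k) + 2) * (3 * real (Suc k) + 1) * c (Suc k) * x ^ Suc k)
      sums (27 * (x^2 * binom3_ser3 x) + 54 * (x * binom3_ser2 x) + 6 * binom3_ser1 x - 2)"
    by (subst sums_Suc_iff) (simp add: c_def diffs_def binom3_coeff_1)
  have "(\<lambda>k. x * (4 * (real k * (real k - 1) * c k * x ^ k) + 14 * (real k * c k * x ^ k) + 6 * (c k * x ^ k)))
      sums (x * (4 * (x^2 * binom3_ser3 x) + 14 * (x * binom3_ser2 x) + 6 * binom3_ser1 x))"
    by (intro sums_add sums_mult s0 s1 s2)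
  moreover have "x * (4 * (real k * (real k - 1) * c k * x ^ k) + 14 * (real k * c k * x ^ k) + 6 * (c k * x ^ k))
     = 3 * (3 * real (Suc k) + 2) * (3 * real (Suc k) + 1) * c (Suc k) * x ^ Suc k" for k
  proof -
    \<comment> \<open>In terms of \<open>c\<close> the factors k + 1 and k + 2 of the recurrence are
      absorbed, and 2 * (k + 1) * (2 * k + 3) remains.\<close>
    have "3 * (3 * real (Suc k) + 2) * (3 * real (Suc k) + 1) * c (Suc k) = (4 * real k ^ 2 + 10 * k + 6) * c k"
      using binom3_coeff_Suc[of "Suc k"] by (simp add: c_def diffs_def algebra_simps power2_eq_square)
    then have "3 * (3 * real (Suc k) + 2) * (3 * real (Suc k) + 1) * c (Suc k) * x ^ Suc k
       = (4 * real k ^ 2 + 10 * k + 6) * c k * x ^ Suc k" by simp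
    then show ?thesis by (simp add: algebra_simps power2_eq_square)
  qed
  ultimately have "27 * (x^2 * binom3_ser3 x) + 54 * (x * binom3_ser2 x) + 6 * binom3_ser1 x - 2
     = x * (4 * (x^2 * binom3_ser3 x) + 14 * (x * binom3_ser2 x) + 6 * binom3_ser1 x)"
    using lhs sums_unique2 by simp
  then show ?thesis by (simp add: algebra_simps power2_eq_square power3_eq_cube)
qed

section \<open>Polynomial identities behind the variation of constants\<close>

lemma binom3_ode_subst:
  fixes v i :: real
  assumes "i * (1 - v^3) = 1" "x = - 27 * v^3 * i^2"
    "(27 - 4 * x) * x^2 * R2 + (54 * x - 14 * x^2) * R1 + (6 - 6 * x) * R = 2"
  shows "27 * (1 + v^3)^2 * i^2 * x^2 * R2 = 2 - (54 * x - 14 * x^2) * R1 - (6 - 6 * x) * R"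
proof -
  \<comment> \<open>The substitution turns the singular factor of the equation into a perfect
    square, since (1 - v^3)^2 + 4 * v^3 = (1 + v^3)^2.\<close>
  have "27 - 4 * x = 27 * (1 + v^3)^2 * i^2" using assms(1,2) by algebra
  then show ?thesis using assms(3) by algebra
qed

text \<open>
  In this lemma and the next, the left-hand side is the derivative as the differentiation rules
  produce it, with $R, R_1, R_2$ standing for the first three derivatives of $S$ at $x$ and $i = 1/(1-v^3)$. The term in
  $R_2$ is a multiple of the left-hand side of \<open>ode\<close>; after its elimination the coefficients of $R$
  and $R_1$ vanish separately.
\<close>

lemma amp0_deriv_identity:
  fixes v i :: real
  assumes iu: "i * (1 - v^3) = 1" and x: "x = - 27 * v^3 * i^2"
    and ode: "27 * (1 + v^3)^2 * i^2 * x^2 * R2 = 2 - (54 * x - 14 * x^2) * R1 - (6 - 6 * x) * R"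
    and i': "i' = 3 * v^2 * i^2"
    and x': "x' = - 81 * v^2 * i^3 * (1 + v^3)"
  shows "- 27 * (2 * v * (2 - v^3) * i^2 * R - 3 * v^2 * v^2 * i^2 * R + (2 - v^3) * v^2 * 2 * i * i' * R
        + (2 - v^3) * v^2 * i^2 * R1 * x')
     + 81 * (2 * (1 + v^3) * 3 * v^2 * v^2 * i^3 * (R + x * R1) + (1+v^3)^2 * 2 * v * i^3 * (R + x * R1)
       + (1+v^3)^2 * v^2 * 3 * i^2 * i' * (R + x * R1) + (1+v^3)^2 * v^2 * i^3 * x' * (R1 + R1 + x * R2))
     - 24 * v * i - 12 * v^2 * i' = - 6 * v * i" (is "?l = _")
proof -
  \<comment> \<open>The cofactor comes from \<open>v * x' = 3 * i * (1 + v^3) * x\<close>.\<close>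
  have "81 * (1 + v^3)^2 * v^2 * i^3 * x' * x * R2 = 9 * v * i^2 * (1 + v^3) * (27 * (1 + v^3)^2 * i^2 * x^2 * R2)"
    unfolding x x' by algebra
  then have 1: "81 * (1 + v^3)^2 * v^2 * i^3 * x' * x * R2
      = 9 * v * i^2 * (1 + v^3) * (2 - (54 * x - 14 * x^2) * R1 - (6 - 6 * x) * R)"
    unfolding ode .
  have "?l = (?l - 81 * (1 + v^3)^2 * v^2 * i^3 * x' * x * R2)
     + 9 * v * i^2 * (1 + v^3) * (2 - (54 * x - 14 * x^2) * R1 - (6 - 6 * x) * R)"
    unfolding 1 by simp
  also have "\<dots> = 27 * v * (- (4 - 2 * v^3) * i^2 + 3 * v^3 * i^2 - 6 * (2 - v^3) * v^3 * i^3
       + 18 * (1 + v^3) * v^3 * i^3 + 6 * (1 + v^3)^2 * i^3 + 27 * (1 + v^3)^2 * v^3 * i^4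
       - 2 * i^2 * (1 + v^3) - 54 * v^3 * (1 + v^3) * i^4) * R +
    (- 27 * (2 - v^3) * v^2 * i^2 * x' + 81 * x * (6 * (1 + v^3) * v^4 * i^3 + 2 * (1+v^3)^2 * v * i^3
       + 9 * (1 + v^3)^2 * v^4 * i^4) + 162 * (1 + v^3)^2 * v^2 * i^3 * x' - 9 * v * i^2 * (1 + v^3) * (54 * x - 14 * x^2)) * R1
    - 24 * v * i - 36 * v^4 * i^2 + 18 * v * i^2 * (1 + v^3)"
    unfolding x x' i' by algebra
  also have "- (4 - 2 * v^3) * i^2 + 3 * v^3 * i^2 - 6 * (2 - v^3) * v^3 * i^3
       + 18 * (1 + v^3) * v^3 * i^3 + 6 * (1 + v^3)^2 * i^3 + 27 * (1 + v^3)^2 * v^3 * i^4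
       - 2 * i^2 * (1 + v^3) - 54 * v^3 * (1 + v^3) * i^4 = 0"
    using iu by algebra
  also have "(- 27 * (2 - v^3) * v^2 * i^2 * x' + 81 * x * (6 * (1 + v^3) * v^4 * i^3 + 2 * (1+v^3)^2 * v * i^3
       + 9 * (1 + v^3)^2 * v^4 * i^4) + 162 * (1 + v^3)^2 * v^2 * i^3 * x' - 9 * v * i^2 * (1 + v^3) * (54 * x - 14 * x^2)) = 0"
    unfolding x x' using iu by algebra
  also have "27 * v * 0 * R + 0 * R1 - 24 * v * i - 36 * v^4 * i^2 + 18 * v * i^2 * (1 + v^3) = - 6 * v * i"
    using iu by algebra
  finally show ?thesis .
qed

lemma amp1_deriv_identity:
  fixes v i :: real
  assumes iu: "i * (1 - v^3) = 1" and x: "x = - 27 * v^3 * i^2"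
    and ode: "27 * (1 + v^3)^2 * i^2 * x^2 * R2 = 2 - (54 * x - 14 * x^2) * R1 - (6 - 6 * x) * R"
    and i': "i' = 3 * v^2 * i^2"
    and x': "x' = - 81 * v^2 * i^3 * (1 + v^3)"
  shows "- 81 * (2 * (1 + v^3) * 3 * v^2 * v * i^3 * (R + x * R1) + (1+v^3)^2 * i^3 * (R + x * R1)
       + (1+v^3)^2 * v * 3 * i^2 * i' * (R + x * R1) + (1+v^3)^2 * v * i^3 * x' * (R1 + R1 + x * R2))
     + 12 * i + 12 * v * i'
     + 27 * ((1 - 2 * v^3) * i^2 * R - 6 * v^2 * v * i^2 * R + (1 - 2 * v^3) * v * 2 * i * i' * R
        + (1 - 2 * v^3) * v * i^2 * R1 * x') = - 6 * i" (is "?l = _")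
proof -
  have "81 * (1 + v^3)^2 * v * i^3 * x' * x * R2 = 9 * i^2 * (1 + v^3) * (27 * (1 + v^3)^2 * i^2 * x^2 * R2)"
    unfolding x x' by algebra
  then have 1: "81 * (1 + v^3)^2 * v * i^3 * x' * x * R2
      = 9 * i^2 * (1 + v^3) * (2 - (54 * x - 14 * x^2) * R1 - (6 - 6 * x) * R)"
    unfolding ode .
  have "?l = (?l + 81 * (1 + v^3)^2 * v * i^3 * x' * x * R2)
     - 9 * i^2 * (1 + v^3) * (2 - (54 * x - 14 * x^2) * R1 - (6 - 6 * x) * R)"
    unfolding 1 by simp
  also have "\<dots> = (- 81 * (6 * (1 + v^3) * v^3 * i^3 + (1 + v^3)^2 * i^3 + 9 * (1 + v^3)^2 * v^3 * i^4)
       + 27 * ((1 - 2 * v^3) * i^2 - 6 * v^3 * i^2 + 6 * (1 - 2 * v^3) * v^3 * i^3)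
       + 9 * i^2 * (1 + v^3) * (6 + 162 * v^3 * i^2)) * R +
    (- 81 * x * (6 * (1 + v^3) * v^3 * i^3 + (1 + v^3)^2 * i^3 + 9 * (1 + v^3)^2 * v^3 * i^4)
       - 162 * (1 + v^3)^2 * v * i^3 * x' + 27 * (1 - 2 * v^3) * v * i^2 * x' + 9 * i^2 * (1 + v^3) * (54 * x - 14 * x^2)) * R1
    + 12 * i + 36 * v^3 * i^2 - 18 * i^2 * (1 + v^3)"
    unfolding x x' i' by algebra
  also have "(- 81 * (6 * (1 + v^3) * v^3 * i^3 + (1 + v^3)^2 * i^3 + 9 * (1 + v^3)^2 * v^3 * i^4)
       + 27 * ((1 - 2 * v^3) * i^2 - 6 * v^3 * i^2 + 6 * (1 - 2 * v^3) * v^3 * i^3)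
       + 9 * i^2 * (1 + v^3) * (6 + 162 * v^3 * i^2)) = 0"
    using iu by algebra
  also have "(- 81 * x * (6 * (1 + v^3) * v^3 * i^3 + (1 + v^3)^2 * i^3 + 9 * (1 + v^3)^2 * v^3 * i^4)
       - 162 * (1 + v^3)^2 * v * i^3 * x' + 27 * (1 - 2 * v^3) * v * i^2 * x' + 9 * i^2 * (1 + v^3) * (54 * x - 14 * x^2)) = 0"
    unfolding x x' using iu by algebra
  also have "0 * R + 0 * R1 + 12 * i + 36 * v^3 * i^2 - 18 * i^2 * (1 + v^3) = - 6 * i"
    using iu by algebra
  finally show ?thesis .
qed

section \<open>The substitution, its domain, and the derivatives of the elementary functions\<close>

definition recip3 :: "real \<Rightarrow> real" where "recip3 v = 1 / (1 - v^3)"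

definition ser_arg :: "real \<Rightarrow> real" where "ser_arg v = - 27 * v^3 * recip3 v^2"

text \<open>With \<omega> a primitive cube root of unity, \<open>theta v\<close> is up to sign the
  argument of 1 - \<omega> v when \<open>v > -2\<close>, and \<open>lam v\<close> below is the
  logarithm of |1 - \<omega> v|^2 / (1 - v)^2.\<close>

definition theta :: "real \<Rightarrow> real" where "theta v = arctan (sqrt 3 * v / (2 + v))"

definition lam :: "real \<Rightarrow> real" where "lam v = ln ((1 - v^3) / (1 - v)^3)"

text \<open>
  On this interval $|x| < 27/4$; for $v < 0$ this only needs $v \ne -1$, and for $v > 0$ it amounts to
  $v^6 - 6v^3 + 1 > 0$.
\<close>

definition ser_dom :: "real set" where "ser_dom = {-1<..<root 3 (3 - 2 * sqrt 2)}"

lemma ser_dom_iff: "v \<in> ser_dom \<longleftrightarrow> -1 < v^3 \<and> v^3 < 3 - 2 * sqrt 2"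
proof -
  have e: "root 3 (v^3) = v" by (simp add: odd_real_root_power_cancel)
  have "-1 < v \<longleftrightarrow> root 3 (-1) < root 3 (v^3)" unfolding e by (simp add: real_root_minus)
  moreover have "v < root 3 (3 - 2 * sqrt 2) \<longleftrightarrow> root 3 (v^3) < root 3 (3 - 2 * sqrt 2)" unfolding e ..
  ultimately show ?thesis by (simp add: ser_dom_def del: real_root_eq_iff)
qed

lemma ser_domD:
  assumes "v \<in> ser_dom"
  shows "-1 < v" "v < 1" "v^3 < 1" "norm (ser_arg v) < 27 / 4"
proof -
  define w where "w = v^3"
  have w: "-1 < w" "w < 3 - 2 * sqrt 2" using assms ser_dom_iff w_def by auto
  have "sqrt 2 > 1" by simp
  then have w1: "w < 1" using w by linarith
  then show "v^3 < 1" by (simp add: w_def)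
  show "-1 < v" using assms by (simp add: ser_dom_def)
  show "v < 1" using \<open>v^3 < 1\<close> by (metis not_less one_le_power)
  \<comment> \<open>This is the bound on \<open>ser_arg v\<close> with denominators cleared. For
    \<open>w\<close> < 0 it says (1 + w)^2 > 0, otherwise (3 - w)^2 > 8.\<close>
  have "4 * \<bar>w\<bar> < (1 - w)^2"
  proof (cases "w < 0")
    case True
    have "0 < (1 + w)^2" using w by simp
    then show ?thesis using True by (simp add: power2_eq_square algebra_simps)
  next
    case False
    have "(2 * sqrt 2)^2 < (3 - w)^2" using w by (intro power_strict_mono) auto
    then show ?thesis using False by (simp add: power2_eq_square algebra_simps)
  qed
  then show "norm (ser_arg v) < 27 / 4"
    using w1 unfolding ser_arg_def recip3_def w_def[symmetric] by (simp add: abs_mult field_simps)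
qed

lemma deriv_recip3:
  "v^3 < 1 \<Longrightarrow> (recip3 has_real_derivative 3 * v^2 * (recip3 v)^2) (at v)"
  unfolding recip3_def[abs_def]
  by (auto intro!: derivative_eq_intros simp: power2_eq_square)

text \<open>Modulo this relation, rational identities in \<open>v\<close> become polynomial ones in
  \<open>v\<close> and \<open>i\<close>, within reach of \<open>algebra\<close>.\<close>

lemma recip3_mult: "v^3 < 1 \<Longrightarrow> recip3 v * (1 - v^3) = 1"
  by (simp add: recip3_def)

lemma deriv_ser_arg:
  assumes "v^3 < 1"
  shows "(ser_arg has_real_derivative - 81 * v^2 * recip3 v^3 * (1 + v^3)) (at v)"
  unfolding ser_arg_def[abs_def]
  apply (rule deriv_recip3 derivative_eq_intros assms refl)+
  using recip3_mult[OF assms] by simp algebra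

lemma deriv_theta:
  assumes "-1 < v" "v < 1" "v^3 < 1"
  shows "(theta has_real_derivative sqrt 3 / 2 * (1 - v) * recip3 v) (at v)"
proof -
  define P where "P = 1 + v + v^2"
  have f: "1 - v^3 = (1 - v) * P" unfolding P_def by algebra
  have p: "P > 0" using assms by (simp add: P_def add_pos_nonneg)
  have q: "(2 + v)^2 + 3 * v^2 = 4 * P" unfolding P_def by algebra
  have "(theta has_real_derivative inverse (1 + (sqrt 3 * v / (2 + v))^2) *
      ((sqrt 3 * (2 + v) - sqrt 3 * v) / (2 + v)^2)) (at v)"
    unfolding theta_def[abs_def] using assms
    by (auto intro!: derivative_eq_intros simp: power2_eq_square)
  also have "1 + (sqrt 3 * v / (2 + v))^2 = ((2 + v)^2 + 3 * v^2) / (2 + v)^2"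
    using assms by (simp add: power_divide power_mult_distrib field_simps)
  also have "inverse \<dots> * ((sqrt 3 * (2 + v) - sqrt 3 * v) / (2 + v)^2) = 2 * sqrt 3 / ((2 + v)^2 + 3 * v^2)"
    using assms by (simp add: field_simps)
  also have "\<dots> = sqrt 3 / 2 * (1 - v) * recip3 v"
    using p assms unfolding recip3_def f q P_def[symmetric] by (simp add: field_simps)
  finally show ?thesis .
qed

lemma deriv_lam:
  assumes "-1 < v" "v < 1" "v^3 < 1"
  shows "(lam has_real_derivative 3 * (1 + v) * recip3 v) (at v)"
proof -
  define P where "P = 1 + v + v^2"
  have f: "1 - v^3 = (1 - v) * P" unfolding P_def by algebra
  have p: "P > 0" using assms by (simp add: P_def add_pos_nonneg)
  \<comment> \<open>The split form agrees with \<open>lam\<close> wherever both 1 - v and 1 - v^3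
    are positive, so near the given point; the derivative is then transferred.\<close>
  have "((\<lambda>v. ln (1 - v^3) - 3 * ln (1 - v)) has_real_derivative
     - (3 * v^2) / (1 - v^3) + 3 / (1 - v)) (at v)"
    using assms by (auto intro!: derivative_eq_intros)
  also have "- (3 * v^2) / (1 - v^3) + 3 / (1 - v) = 3 * (1 + v) * recip3 v"
    using p assms unfolding recip3_def f by (simp add: divide_simps) (simp add: P_def)
  finally show ?thesis
  proof (rule DERIV_cong_ev[THEN iffD1, rotated -1])
    have "eventually (\<lambda>v::real. v < 1 \<and> v^3 < 1) (nhds v)"
      using assms by (intro eventually_nhds_in_open[of "{v. v < 1 \<and> v^3 < 1}", simplified]
          open_Collect_conj open_Collect_less continuous_intros) auto
    then show "eventually (\<lambda>v. ln (1 - v^3) - 3 * ln (1 - v) = lam v) (nhds v)"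
      by eventually_elim (simp add: lam_def ln_div ln_realpow)
  qed auto
qed

section \<open>The amplitudes and the closed form of the series\<close>

text \<open>
  The amplitudes $f$ and $g$ of the variation of constants, multiplied out so that no division by
  $v$ remains.
\<close>

definition amp0 :: "real \<Rightarrow> real" where
  "amp0 v = (let i = recip3 v; x = ser_arg v in
    - 27 * ((2 - v^3) * v^2 * i^2 * binom3_ser1 x) + 81 * ((1 + v^3)^2 * v^2 * i^3 * (binom3_ser1 x + x * binom3_ser2 x)) - 12 * v^2 * i)"

definition amp1 :: "real \<Rightarrow> real" where
  "amp1 v = (let i = recip3 v; x = ser_arg v in
    - 81 * ((1 + v^3)^2 * v * i^3 * (binom3_ser1 x + x * binom3_ser2 x)) + 12 * v * i + 27 * ((1 - 2 * v^3) * v * i^2 * binom3_ser1 x))"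

text \<open>Differentiation brings in the third derivative of the series; the differential equation
  eliminates it and everything else involving the series cancels.\<close>

lemma deriv_amps:
  assumes v: "v \<in> ser_dom"
  shows "(amp0 has_real_derivative - 6 * v * recip3 v) (at v)"
    and "(amp1 has_real_derivative - 6 * recip3 v) (at v)"
proof -
  note d = ser_domD[OF v]
  define i where "i = recip3 v"
  define i' where "i' = 3 * v^2 * i^2"
  define x where "x = ser_arg v"
  define x' where "x' = - 81 * v^2 * i^3 * (1 + v^3)"
  have i: "i * (1 - v^3) = 1" using d recip3_mult by (simp add: i_def)
  have xi: "x = - 27 * v^3 * i^2" by (simp add: x_def i_def ser_arg_def)
  have ode: "27 * (1 + v^3)^2 * i^2 * x^2 * binom3_ser3 x = 2 - (54 * x - 14 * x^2) * binom3_ser2 x - (6 - 6 * x) * binom3_ser1 x"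
    by (rule binom3_ode_subst[OF i xi]) (use binom3_ser1_ode d(4) in \<open>simp add: x_def\<close>)
  have Di: "(recip3 has_real_derivative i') (at v)"
    using deriv_recip3[OF d(3)] by (simp add: i'_def i_def)
  have Dx: "(ser_arg has_real_derivative x') (at v)"
    using deriv_ser_arg[OF d(3)] by (simp add: x'_def i_def)
  have DR: "((\<lambda>v. binom3_ser1 (ser_arg v)) has_real_derivative binom3_ser2 x * x') (at v)"
    unfolding x_def by (rule DERIV_chain2[OF DERIV_binom3_ser1 Dx]) (rule d)
  have DR1: "((\<lambda>v. binom3_ser2 (ser_arg v)) has_real_derivative binom3_ser3 x * x') (at v)"
    unfolding x_def by (rule DERIV_chain2[OF DERIV_binom3_ser2 Dx]) (rule d)
  show "(amp0 has_real_derivative - 6 * v * recip3 v) (at v)"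
    unfolding amp0_def[abs_def] Let_def
    apply (rule Di Dx DR DR1 derivative_eq_intros refl)+
    \<comment> \<open>The identity is used backwards: the elementary target is expanded into the raw
      output of the differentiation rules.\<close>
    unfolding i_def[symmetric] x_def[symmetric] amp0_deriv_identity[OF i xi ode i'_def x'_def, symmetric]
    by (simp add: algebra_simps power2_eq_square power3_eq_cube)
  show "(amp1 has_real_derivative - 6 * recip3 v) (at v)"
    unfolding amp1_def[abs_def] Let_def
    apply (rule Di Dx DR DR1 derivative_eq_intros refl)+
    unfolding i_def[symmetric] x_def[symmetric] amp1_deriv_identity[OF i xi ode i'_def x'_def, symmetric]
    by (simp add: algebra_simps power2_eq_square power3_eq_cube)
qed

lemma zero_in_ser_dom: "0 \<in> ser_dom"
proof -
  have "(sqrt 8)^2 < (3::real)^2" by simp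
  then have "sqrt 8 < 3" using power_less_imp_less_base by fastforce
  moreover have "sqrt 8 = 2 * sqrt 2" using real_sqrt_mult[of 4 2] by simp
  ultimately show ?thesis by (simp add: ser_dom_iff)
qed

text \<open>Compares antiderivatives on the interval, with 0 as base point because all functions to
  be compared vanish there.\<close>

lemma eq_on_ser_domI:
  assumes "\<And>u. u \<in> ser_dom \<Longrightarrow> (f has_real_derivative h u) (at u)"
    "\<And>u. u \<in> ser_dom \<Longrightarrow> (g has_real_derivative h u) (at u)"
    "f 0 = g 0" "v \<in> ser_dom"
  shows "f v = g v"
proof -
  have "convex ser_dom" by (simp add: ser_dom_def)
  moreover have "((\<lambda>u. f u - g u) has_real_derivative 0) (at u within ser_dom)" if "u \<in> ser_dom" for u
    using DERIV_diff[OF assms(1,2)[OF that]] by (simp add: has_field_derivative_at_within)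
  ultimately obtain c where c: "\<And>u. u \<in> ser_dom \<Longrightarrow> f u - g u = c"
    using has_field_derivative_zero_constant[of ser_dom "\<lambda>u. f u - g u"] by blast
  show ?thesis using c[OF zero_in_ser_dom] c[OF assms(4)] assms(3) by simp
qed

text \<open>The derivatives match because -6u = 3(1 - u) - 3(1 + u); for \<open>amp1\<close> the two
  terms add up to 6 instead.\<close>

lemma amp0_eq: "v \<in> ser_dom \<Longrightarrow> amp0 v = 2 * sqrt 3 * theta v - lam v"
proof (rule eq_on_ser_domI[OF deriv_amps(1)])
  fix u assume "u \<in> ser_dom"
  note d = ser_domD[OF this]
  have "((\<lambda>u. 2 * sqrt 3 * theta u - lam u) has_real_derivative
     2 * sqrt 3 * (sqrt 3 / 2 * (1 - u) * recip3 u) - 3 * (1 + u) * recip3 u) (at u)"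
    by (intro DERIV_diff DERIV_cmult deriv_theta deriv_lam d)
  then show "((\<lambda>u. 2 * sqrt 3 * theta u - lam u) has_real_derivative - 6 * u * recip3 u) (at u)"
    by (rule DERIV_cong) (simp add: field_simps)
qed (auto simp: amp0_def theta_def lam_def)

lemma amp1_eq: "v \<in> ser_dom \<Longrightarrow> amp1 v = - (2 * sqrt 3 * theta v + lam v)"
proof (rule eq_on_ser_domI[OF deriv_amps(2)])
  fix u assume "u \<in> ser_dom"
  note d = ser_domD[OF this]
  have "((\<lambda>u. - (2 * sqrt 3 * theta u + lam u)) has_real_derivative
     - (2 * sqrt 3 * (sqrt 3 / 2 * (1 - u) * recip3 u) + 3 * (1 + u) * recip3 u)) (at u)"
    by (intro DERIV_minus DERIV_add DERIV_cmult deriv_theta deriv_lam d)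
  then show "((\<lambda>u. - (2 * sqrt 3 * theta u + lam u)) has_real_derivative - 6 * recip3 u) (at u)"
    by (rule DERIV_cong) (simp add: field_simps)
qed (auto simp: amp1_def theta_def lam_def)

lemma binom3_ser_0: "binom3_ser 0 = 0"
  unfolding binom3_ser_def using powser_zero[of binom3_coeff] by (simp add: binom3_coeff_def)

text \<open>Both sides vanish at 0, and both derivatives equal 3 * i * (\<open>amp0\<close> + u *
  \<open>amp1\<close>): on the left by the chain rule, on the right by the closed forms of the
  amplitudes.\<close>

lemma binom3_ser_closed_form: "v \<in> ser_dom \<Longrightarrow> binom3_ser (ser_arg v) = 6 * (theta v)^2 - 1 / 2 * (lam v)^2"
proof (rule eq_on_ser_domI[where f = "\<lambda>v. binom3_ser (ser_arg v)"
      and h = "\<lambda>u. binom3_ser1 (ser_arg u) * (- 81 * u^2 * recip3 u^3 * (1 + u^3))"])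
  fix u assume u: "u \<in> ser_dom"
  note d = ser_domD[OF u]
  define i where "i = recip3 u"
  show "((\<lambda>u. binom3_ser (ser_arg u)) has_real_derivative
      binom3_ser1 (ser_arg u) * (- 81 * u^2 * recip3 u^3 * (1 + u^3))) (at u)"
    by (rule DERIV_chain2[OF DERIV_binom3_ser deriv_ser_arg]) (rule d)+
  \<comment> \<open>The second derivatives of the series and the elementary terms cancel. This is
    the variation-of-constants ansatz with a factor u divided out.\<close>
  have "amp0 u + u * amp1 u = - 27 * u^2 * i^2 * (1 + u^3) * binom3_ser1 (ser_arg u)"
    unfolding amp0_def amp1_def Let_def i_def[symmetric]
    by (simp add: algebra_simps power2_eq_square power3_eq_cube)
  then have "binom3_ser1 (ser_arg u) * (- 81 * u^2 * i^3 * (1 + u^3)) = 3 * i * (amp0 u + u * amp1 u)"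
    by (simp add: power2_eq_square power3_eq_cube)
  also have "\<dots> = 6 * (2 * theta u * (sqrt 3 / 2 * (1 - u) * i)) - 1 / 2 * (2 * lam u * (3 * (1 + u) * i))"
    unfolding amp0_eq[OF u] amp1_eq[OF u] by (simp add: algebra_simps)
  finally have e: "binom3_ser1 (ser_arg u) * (- 81 * u^2 * i^3 * (1 + u^3)) = \<dots>" .
  show "((\<lambda>u. 6 * (theta u)^2 - 1 / 2 * (lam u)^2) has_real_derivative
      binom3_ser1 (ser_arg u) * (- 81 * u^2 * recip3 u^3 * (1 + u^3))) (at u)"
    unfolding i_def[symmetric] e unfolding i_def
    by (rule derivative_eq_intros deriv_theta deriv_lam d refl | simp)+
qed (auto simp: binom3_ser_0 ser_arg_def theta_def lam_def)

section \<open>Binet's formulas and estimates for Fibonacci numbers\<close>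

definition beta :: real where "beta = (1 - sqrt 5) / 2"

lemma alpha_beta: "alpha + beta = 1" "alpha * beta = -1" "alpha - beta = sqrt 5"
  "alpha^2 = alpha + 1" "beta^2 = beta + 1"
  by (simp_all add: alpha_def beta_def field_simps power2_eq_square)

lemma alpha_gt: "alpha > 8 / 5"
proof -
  have "11 / 5 < sqrt 5" by (rule real_less_rsqrt) (simp add: power2_eq_square)
  then show ?thesis by (simp add: alpha_def)
qed

lemma fibn_binet: "sqrt 5 * real_of_int (fibn n) = alpha^n - beta^n"
proof (induction n rule: fibn.induct)
  case (3 n)
  have "sqrt 5 * real_of_int (fibn (Suc (Suc n))) = alpha^n * (alpha + 1) - beta^n * (beta + 1)"
    using 3 by (simp add: algebra_simps)
  then show ?case
    unfolding alpha_beta(4,5)[symmetric] by (simp add: power2_eq_square mult_ac)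
qed (simp_all add: alpha_beta)

lemma lucn_binet: "real_of_int (lucn n) = alpha^n + beta^n"
proof (induction n rule: lucn.induct)
  case (3 n)
  have "real_of_int (lucn (Suc (Suc n))) = alpha^n * (alpha + 1) + beta^n * (beta + 1)"
    using 3 by (simp add: algebra_simps)
  then show ?case
    unfolding alpha_beta(4,5)[symmetric] by (simp add: power2_eq_square mult_ac)
qed (simp_all add: alpha_beta)

lemma inverse_alpha_beta: "inverse alpha = - beta" "inverse beta = - alpha"
  using alpha_beta(2) by (auto intro!: inverse_unique simp: mult.commute)

text \<open>For negative indices the sign convention is exactly what 1/alpha = -beta and 1/beta =
  -alpha produce.\<close>

lemma F_binet: "sqrt 5 * real_of_int (F n) = alpha powi n - beta powi n"
proof (cases "n \<ge> 0")
  case True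
  then show ?thesis using fibn_binet[of "nat n"] by (simp add: F_def power_int_def)
next
  case False
  define k where "k = nat (- n)"
  have "sqrt 5 * real_of_int (F n) = (-1)^(k + 1) * (sqrt 5 * fibn k)"
    using False by (simp add: F_def k_def)
  also have "\<dots> = (- beta)^k - (- alpha)^k"
    unfolding fibn_binet power_minus[of alpha] power_minus[of beta] by (simp add: algebra_simps)
  finally show ?thesis using False by (simp add: power_int_def inverse_alpha_beta k_def)
qed

lemma L_binet: "real_of_int (L n) = alpha powi n + beta powi n"
proof (cases "n \<ge> 0")
  case True
  then show ?thesis using lucn_binet[of "nat n"] by (simp add: L_def power_int_def)
next
  case False
  define k where "k = nat (- n)"
  have "real_of_int (L n) = (-1)^k * real_of_int (lucn k)"
    using False by (simp add: L_def k_def)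
  also have "\<dots> = (- beta)^k + (- alpha)^k"
    unfolding lucn_binet power_minus[of alpha] power_minus[of beta] by (simp add: algebra_simps)
  finally show ?thesis using False by (simp add: power_int_def inverse_alpha_beta k_def)
qed

text \<open>Immediate from Binet once -1 is written as \<open>alpha * beta\<close>. It makes the
  difference of cubes Y^3 - X^3 at each of the two points a single product.\<close>

lemma fibn_add_alpha:
  "fibn m * alpha^(m + n) + (-1)^m * real_of_int (fibn n) = alpha^m * fibn (m + n)"
proof -
  have "sqrt 5 * (fibn m * alpha^(m + n) + (alpha * beta)^m * fibn n)
      = (sqrt 5 * fibn m) * alpha^(m + n) + (alpha * beta)^m * (sqrt 5 * fibn n)"
    by (simp add: algebra_simps)
  also have "\<dots> = alpha^m * (sqrt 5 * fibn (m + n))"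
    unfolding fibn_binet by (simp add: power_add power_mult_distrib algebra_simps)
  finally show ?thesis by (simp add: alpha_beta(2))
qed

lemma fibn_pos: "n > 0 \<Longrightarrow> fibn n > 0"
proof (induction n rule: fibn.induct)
  case (3 n)
  then show ?case by (cases n) auto
qed auto

lemma fibn_nonneg: "fibn n \<ge> 0"
  using fibn_pos[of n] by (cases n) auto

lemma fibn_le_alpha: "fibn n \<le> alpha^n"
proof (induction n rule: fibn.induct)
  case (3 n)
  have "real_of_int (fibn (Suc (Suc n))) \<le> alpha^n * (alpha + 1)"
    using 3 by (simp add: algebra_simps)
  then show ?case
    unfolding alpha_beta(4,5)[symmetric] by (simp add: power2_eq_square mult_ac)
qed (use alpha_gt in simp_all)

lemma fibn_ge_2: "n \<ge> 3 \<Longrightarrow> fibn n \<ge> 2"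
proof (induction n rule: fibn.induct)
  case (3 n)
  then show ?case using fibn_pos[of n] fibn_pos[of "Suc n"] by (cases "n = 0") auto
qed auto

text \<open>Here \<open>r\<close> is the value of v^3 at one of the two points, so the bounds say
  that v lies in \<open>ser_dom\<close>. Up to sign, \<open>r\<close> is at most 1 / (alpha^m *
  F_m).\<close>

lemma fibn_ratio_bounds:
  assumes "m \<ge> 2" "n \<ge> 2"
  defines "r \<equiv> (-1)^(m + 1) * real_of_int (fibn n) / (alpha^(m + n) * fibn m)"
  shows "-1 < r" "r < 3 - 2 * sqrt 2"
proof -
  have fm: "real_of_int (fibn m) \<ge> 1" using fibn_pos[of m] assms by simp
  have a: "alpha > 1" using alpha_gt by simp
  define s where "s = fibn n / (alpha^(m + n) * fibn m)"
  have "s \<ge> 0" using a fibn_nonneg by (simp add: s_def)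
  have s_le: "s \<le> 1 / (alpha^m * fibn m)"
  proof -
    have "fibn n / alpha ^ n \<le> 1" using fibn_le_alpha[of n] a by simp
    then have "(fibn n / alpha ^ n) * (1 / (alpha^m * fibn m)) \<le> 1 * (1 / (alpha^m * fibn m))"
      using a fm by (intro mult_right_mono) auto
    then show ?thesis by (simp add: s_def power_add mult_ac)
  qed
  \<comment> \<open>Chosen because 3 - 2 * 17/12 = 1/6, so that a bound by 1/6 suffices
    below.\<close>
  have "(17 / 12)^2 > (2::real)" by (simp add: power2_eq_square)
  then have sqrt2: "sqrt 2 < 17 / 12" by (intro real_less_lsqrt) auto
  have "1 < alpha^m * fibn m"
  proof -
    have "1 < alpha ^ m" using a assms by (intro one_less_power) auto
    then have "1 * 1 < alpha^m * fibn m" using fm by (intro mult_less_le_imp_less) auto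
    then show ?thesis by simp
  qed
  then have s1: "s < 1" using s_le by (smt (verit) divide_less_eq_1_pos)
  have r: "r = (if odd m then s else - s)"
    by (simp add: r_def s_def)
  show "-1 < r" using \<open>s \<ge> 0\<close> s1 by (auto simp: r)
  show "r < 3 - 2 * sqrt 2"
  proof (cases "odd m")
    case False
    then show ?thesis using sqrt2 \<open>s \<ge> 0\<close> by (simp add: r)
  next
    case True
    \<comment> \<open>A positive \<open>r\<close> needs odd \<open>m\<close>, which excludes 2; from
      3 on, alpha^m * F_m exceeds 6.\<close>
    then have "m \<ge> 3" using assms by (cases "m = 2") auto
    have "6 < (8 / 5) ^ 3 * (2::real)" by (simp add: power3_eq_cube)
    also have "\<dots> \<le> alpha^m * fibn m"
    proof (intro mult_mono)
      have "(8 / 5) ^ 3 \<le> alpha ^ 3" using alpha_gt by (intro power_mono) auto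
      also have "\<dots> \<le> alpha ^ m" using a \<open>m \<ge> 3\<close> by (intro power_increasing) auto
      finally show "(8 / 5) ^ 3 \<le> alpha ^ m" .
      show "2 \<le> real_of_int (fibn m)" using fibn_ge_2[OF \<open>m \<ge> 3\<close>] by linarith
    qed (use a in auto)
    finally have "1 / (alpha^m * fibn m) \<le> 1 / 6" by (simp add: divide_simps)
    then show ?thesis using True s_le sqrt2 by (simp add: r)
  qed
qed

section \<open>Evaluation at the two conjugate points\<close>

lemma binom3_ser_closed_form_quotient:
  fixes X Y :: real
  assumes Y: "Y \<noteq> 0" and d: "-1 < X^3 / Y^3" "X^3 / Y^3 < 3 - 2 * sqrt 2"
  shows "norm (- 27 * X^3 * Y^3 / (Y^3 - X^3)^2) < 27 / 4"
    "binom3_ser (- 27 * X^3 * Y^3 / (Y^3 - X^3)^2) =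
       6 * (arctan (sqrt 3 * X / (2 * Y + X)))^2 - 1 / 2 * (ln ((Y^3 - X^3) / (Y - X)^3))^2"
proof -
  \<comment> \<open>All expressions are homogeneous of degree 0 in \<open>X\<close> and
    \<open>Y\<close>, so a negative \<open>Y\<close> does no harm and the cube roots can stay as
    they occur in the theorem.\<close>
  define v where "v = X / Y"
  have X: "X = v * Y" using Y by (simp add: v_def)
  have v: "v \<in> ser_dom" using d by (simp add: ser_dom_iff v_def power_divide)
  note D = ser_domD[OF v]
  have "Y^3 - X^3 = Y^3 * (1 - v^3)" "Y - X = Y * (1 - v)" "2 * Y + X = Y * (2 + v)"
    unfolding X by algebra+
  then have l: "(Y^3 - X^3) / (Y - X)^3 = (1 - v^3) / (1 - v)^3"
    and t: "sqrt 3 * X / (2 * Y + X) = sqrt 3 * v / (2 + v)"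
    and x: "- 27 * X^3 * Y^3 / (Y^3 - X^3)^2 = ser_arg v"
    using Y unfolding X ser_arg_def recip3_def power2_eq_square
    by (simp_all add: power_mult_distrib power_divide)
  show "norm (- 27 * X^3 * Y^3 / (Y^3 - X^3)^2) < 27 / 4" unfolding x by (rule D)
  show "binom3_ser (- 27 * X^3 * Y^3 / (Y^3 - X^3)^2) =
       6 * (arctan (sqrt 3 * X / (2 * Y + X)))^2 - 1 / 2 * (ln ((Y^3 - X^3) / (Y - X)^3))^2"
    unfolding x l t binom3_ser_closed_form[OF v] theta_def lam_def ..
qed

lemma binom3_ser_sums_Suc:
  assumes "norm x < 27 / 4"
  shows "(\<lambda>k. binom3_coeff (Suc k) * x ^ Suc k) sums binom3_ser x"
proof -
  have "(\<lambda>k. binom3_coeff k * x ^ k) sums binom3_ser x"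
    unfolding binom3_ser_def using summable_binom3_coeff[OF assms] by (rule summable_sums)
  then show ?thesis
    using sums_Suc_iff[of "\<lambda>k. binom3_coeff k * x ^ k" "binom3_ser x"] by (simp add: binom3_coeff_def)
qed

theorem theorem8:
  fixes p q :: int
  fixes z A1 A2 G1 G2 :: real
  assumes "p \<le> -2" "q \<ge> 4" "q > \<bar>p\<bar> + 1"
  defines "z \<equiv> - 27 * real_of_int (F p) * real_of_int (F (p + q)) / (real_of_int (F q))^2"
      and "A1 \<equiv> arctan (sqrt 3 * cbrt (F (p + q)) / (2 * cbrt (alpha powi q * F p) + cbrt (F (p + q))))"
      and "A2 \<equiv> arctan (sqrt 3 * cbrt (F p) / (2 * cbrt (alpha powi q * F (p + q)) + (-1) powi q * cbrt (F p)))"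
      and "G1 \<equiv> ln ((-1) powi p * F q / (cbrt (alpha powi p * F (p + q)) - cbrt (alpha powi (p + q) * F p)) ^ 3)"
      and "G2 \<equiv> ln (alpha powi (p + q) * F q / (cbrt (alpha powi q * F (p + q)) - (-1) powi q * cbrt (F p)) ^ 3)"
  shows "(\<lambda>k. z ^ (k + 1) * F ((2 * p + q) * int (k + 1)) / (real ((k + 1)^2) * real ((3 * (k + 1)) choose (k + 1))))
           sums (6 / sqrt 5 * (A1\<^sup>2 - A2\<^sup>2) - sqrt 5 / 10 * (G1\<^sup>2 - G2\<^sup>2))
       \<and> (\<lambda>k. z ^ (k + 1) * L ((2 * p + q) * int (k + 1)) / (real ((k + 1)^2) * real ((3 * (k + 1)) choose (k + 1))))
           sums (6 * (A1\<^sup>2 + A2\<^sup>2) - 1 / 2 * (G1\<^sup>2 + G2\<^sup>2))"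
proof -
  \<comment> \<open>The hypotheses give p + q \<ge> 2, so all indices reduce to natural numbers at
    least 2.\<close>
  define m n where "m = nat (- p)" and "n = nat (p + q)"
  have mn: "m \<ge> 2" "n \<ge> 2" and p: "p = - int m" and q: "q = int (m + n)" and pq: "p + q = int n"
    using assms(1-3) by (auto simp: m_def n_def)
  have a0: "alpha > 0" using alpha_gt by simp
  have b0: "beta \<noteq> 0" using alpha_beta(2) by auto
  define fm fn fq where "fm = real_of_int (fibn m)" and "fn = real_of_int (fibn n)"
    and "fq = real_of_int (fibn (m + n))"
  have f0: "fm > 0" "fn > 0" "fq > 0" using mn fibn_pos by (auto simp: fm_def fn_def fq_def)
  define e where "e = (-1 :: real)^(m + 1)"
  have Fp: "real_of_int (F p) = e * fm"
    using mn by (simp add: p F_def e_def fm_def)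
  have Fpq: "real_of_int (F (p + q)) = fn" unfolding pq by (simp add: F_def fn_def)
  have Fq: "real_of_int (F q) = fq" unfolding q by (simp add: F_def fq_def nat_int_add)
  have pw: "alpha powi q = alpha^(m + n)" "alpha powi (p + q) = alpha^n" "(-1::real) powi q = (-1)^(m + n)"
    unfolding pq unfolding q by (simp_all only: power_int_of_nat)
  have pwp: "alpha powi p = 1 / alpha^m" "(-1::real) powi p = (-1)^m"
    by (simp_all add: p power_int_minus divide_inverse flip: power_inverse)
  have ee: "e * e = 1" "e = - ((-1)^m)" by (simp_all add: e_def flip: power_add mult_2)
  have id1: "fm * alpha^(m + n) + (-1)^m * fn = alpha^m * fq"
    using fibn_add_alpha[of m n] by (simp add: fm_def fn_def fq_def)
  have id2: "fn * alpha^(m + n) + (-1)^n * fm = alpha^n * fq"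
    using fibn_add_alpha[of n m] by (simp add: fm_def fn_def fq_def add.commute)

  define X1 Y1 where "X1 = cbrt fn" and "Y1 = cbrt (alpha^(m + n) * (e * fm))"
  have c1: "X1^3 = fn" "Y1^3 = alpha^(m + n) * (e * fm)"
    by (simp_all add: X1_def Y1_def odd_real_root_pow)
  have Y1: "Y1 \<noteq> 0" using a0 f0 by (simp add: Y1_def e_def)
  have diff1: "Y1^3 - X1^3 = e * (alpha^m * fq)"
    unfolding c1 id1[symmetric] using ee(1) by (simp add: ee(2) algebra_simps)
  define x1 where "x1 = z * alpha powi (2 * p + q)"
  have "2 * p + q = int n - int m" using p pq by simp
  then have pw1: "alpha powi (2 * p + q) = alpha^n / alpha^m" "beta powi (2 * p + q) = beta^n / beta^m"
    using a0 b0 by (simp_all add: power_int_diff)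
  have x1: "- 27 * X1^3 * Y1^3 / (Y1^3 - X1^3)^2 = x1"
    unfolding diff1 unfolding c1 x1_def z_def Fp Fpq Fq pw1
    using a0 f0 ee(1) by (simp add: power_mult_distrib power2_eq_square power_add field_simps)
  have r1: "X1^3 / Y1^3 = (-1)^(m + 1) * real_of_int (fibn n) / (alpha^(m + n) * fibn m)"
    unfolding c1 fm_def[symmetric] fn_def[symmetric] e_def[symmetric]
    using a0 f0 ee(1) by (simp add: divide_simps e_def)
  note res1 = binom3_ser_closed_form_quotient[OF Y1 fibn_ratio_bounds[OF mn, folded r1], unfolded x1]
  have A1: "A1 = arctan (sqrt 3 * X1 / (2 * Y1 + X1))"
    unfolding A1_def Fp Fpq pw X1_def Y1_def ..
  \<comment> \<open>Both cube roots in \<open>G1\<close> share the factor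
    \<open>cbrt (1 / alpha^m)\<close>. Its cube accounts for alpha^m in \<open>diff1\<close>, and
    the sign from swapping \<open>X1\<close> and \<open>Y1\<close> turns (-1)^p into
    \<open>e\<close>.\<close>
  have "cbrt (alpha powi p * F (p + q)) = cbrt (1 / alpha^m) * X1"
    unfolding pwp Fpq X1_def by (rule real_root_mult)
  moreover have "cbrt (alpha powi (p + q) * F p) = cbrt (1 / alpha^m) * Y1"
    unfolding pw Fp Y1_def real_root_mult[symmetric] using a0 by (simp add: power_add)
  ultimately have "(cbrt (alpha powi p * F (p + q)) - cbrt (alpha powi (p + q) * F p))^3
      = cbrt (1 / alpha^m)^3 * (X1 - Y1)^3"
    by (simp add: power_mult_distrib flip: right_diff_distrib)
  also have "cbrt (1 / alpha^m)^3 = 1 / alpha^m" by (rule odd_real_root_pow) simp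
  also have "(X1 - Y1)^3 = - ((Y1 - X1)^3)" by algebra
  finally have G1: "G1 = ln ((Y1^3 - X1^3) / (Y1 - X1)^3)"
    unfolding G1_def diff1 Fq pwp ee(2) by (simp add: mult_ac)

  define E where "E = (-1 :: real)^(m + n)"
  have EE: "E * E = 1" "E = - e * (-1)^n"
    unfolding E_def e_def by (simp flip: power_mult_distrib) (simp add: power_add)
  then have E3: "E^3 = E" by (simp add: power3_eq_cube)
  \<comment> \<open>The sign \<open>E\<close> = (-1)^q is put into \<open>X2\<close>; it survives
    cubing and gives the denominators of \<open>A2\<close> and \<open>G2\<close> their stated
    form.\<close>
  define X2 Y2 where "X2 = E * cbrt (e * fm)" and "Y2 = cbrt (alpha^(m + n) * fn)"
  have c2: "X2^3 = E * (e * fm)" "Y2^3 = alpha^(m + n) * fn"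
    by (simp_all add: X2_def Y2_def odd_real_root_pow power_mult_distrib E3)
  have Y2: "Y2 \<noteq> 0" using a0 f0 by (simp add: Y2_def)
  have diff2: "Y2^3 - X2^3 = alpha^n * fq"
    unfolding c2 id2[symmetric] EE(2) using ee(1) by (simp add: algebra_simps)
  define x2 where "x2 = z * beta powi (2 * p + q)"
  \<comment> \<open>The conjugate point is rewritten in powers of \<open>alpha\<close> by means of
    alpha * beta = -1.\<close>
  have bpw: "beta^n / beta^m = E * alpha^m / alpha^n"
  proof -
    have ab: "alpha^k * beta^k = (-1)^k" for k
      by (simp add: alpha_beta(2) flip: power_mult_distrib)
    have "alpha^n * beta^n = E * (alpha^m * beta^m)"
      unfolding ab by (cases "even m") (simp_all add: E_def power_add)
    then show ?thesis using a0 b0 by (simp add: divide_simps mult_ac)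
  qed
  have x2: "- 27 * X2^3 * Y2^3 / (Y2^3 - X2^3)^2 = x2"
    unfolding diff2 unfolding c2 x2_def z_def Fp Fpq Fq pw1 bpw
    using a0 f0 by (simp add: power_mult_distrib power2_eq_square power_add field_simps)
  have r2: "X2^3 / Y2^3 = (-1)^(n + 1) * real_of_int (fibn m) / (alpha^(n + m) * fibn n)"
    unfolding c2 fm_def[symmetric] fn_def[symmetric] EE(2)
    using a0 f0 ee(1) by (simp add: add.commute)
  note res2 = binom3_ser_closed_form_quotient[OF Y2 fibn_ratio_bounds[OF mn(2,1), folded r2], unfolded x2]
  \<comment> \<open>The numerator of \<open>A2\<close> lacks the sign \<open>E\<close>, so the two
    arctangents may differ in sign; only their squares enter.\<close>
  have A2: "A2^2 = (arctan (sqrt 3 * X2 / (2 * Y2 + X2)))^2"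
    unfolding A2_def Fp Fpq pw E_def[symmetric] Y2_def X2_def
    by (cases "even (m + n)") (simp_all add: E_def arctan_minus)
  have G2: "G2 = ln ((Y2^3 - X2^3) / (Y2 - X2)^3)"
    unfolding diff2 unfolding G2_def Fp Fpq Fq pw E_def[symmetric] Y2_def X2_def ..

  note S1 = binom3_ser_sums_Suc[OF res1(1), unfolded res1(2) A1[symmetric] G1[symmetric]]
  note S2 = binom3_ser_sums_Suc[OF res2(1), unfolded res2(2) A2[symmetric] G2[symmetric]]
  have xp: "x1 ^ k = z ^ k * alpha powi ((2 * p + q) * int k)"
    "x2 ^ k = z ^ k * beta powi ((2 * p + q) * int k)" for k
    by (simp_all add: x1_def x2_def power_mult_distrib power_int_mult)
  have coeff: "w / (real ((k + 1)^2) * real ((3 * (k + 1)) choose (k + 1))) = binom3_coeff (Suc k) * w" for w k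
    by (simp add: binom3_coeff_def)
  have "z ^ (k + 1) * F ((2 * p + q) * int (k + 1)) / (real ((k + 1)^2) * real ((3 * (k + 1)) choose (k + 1)))
      = 1 / sqrt 5 * (binom3_coeff (Suc k) * x1 ^ Suc k - binom3_coeff (Suc k) * x2 ^ Suc k)" for k
  proof -
    have "real_of_int (F j) = 1 / sqrt 5 * (alpha powi j - beta powi j)" for j
      using F_binet[of j] by (simp add: field_simps)
    then show ?thesis unfolding coeff xp Suc_eq_plus1 by (simp only: right_diff_distrib mult_ac)
  qed
  moreover have "(\<lambda>k. 1 / sqrt 5 * (binom3_coeff (Suc k) * x1 ^ Suc k - binom3_coeff (Suc k) * x2 ^ Suc k)) sums
      (1 / sqrt 5 * ((6 * A1^2 - 1 / 2 * G1^2) - (6 * A2^2 - 1 / 2 * G2^2)))"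
    by (intro sums_mult sums_diff S1 S2)
  moreover have "1 / sqrt 5 * ((6 * A1^2 - 1 / 2 * G1^2) - (6 * A2^2 - 1 / 2 * G2^2)) =
      6 / sqrt 5 * (A1\<^sup>2 - A2\<^sup>2) - sqrt 5 / 10 * (G1\<^sup>2 - G2\<^sup>2)"
  proof -
    define r where "r = 1 / sqrt 5"
    have r: "6 / sqrt 5 = 6 * r" "sqrt 5 / 10 = r / 2" by (simp_all add: r_def field_simps)
    show ?thesis unfolding r r_def[symmetric] by (simp add: algebra_simps)
  qed
  moreover have "z ^ (k + 1) * L ((2 * p + q) * int (k + 1)) / (real ((k + 1)^2) * real ((3 * (k + 1)) choose (k + 1)))
      = binom3_coeff (Suc k) * x1 ^ Suc k + binom3_coeff (Suc k) * x2 ^ Suc k" for k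
    unfolding coeff xp Suc_eq_plus1 L_binet by (simp only: distrib_left mult_ac)
  moreover have "(\<lambda>k. binom3_coeff (Suc k) * x1 ^ Suc k + binom3_coeff (Suc k) * x2 ^ Suc k) sums
      ((6 * A1^2 - 1 / 2 * G1^2) + (6 * A2^2 - 1 / 2 * G2^2))"
    by (intro sums_add S1 S2)
  moreover have "(6 * A1^2 - 1 / 2 * G1^2) + (6 * A2^2 - 1 / 2 * G2^2) =
      6 * (A1\<^sup>2 + A2\<^sup>2) - 1 / 2 * (G1\<^sup>2 + G2\<^sup>2)"
    by (simp add: field_simps)
  ultimately show ?thesis by (simp only: simp_thms)
qed

end
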